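(* Let $\mu\in\mathcal{P}(\mathcal{X})$, and let $I,J\subseteq\{1,\dots,K\}$ be disjoint and non-empty, and denote by $\mu_I,\mu_J,\mu_{I,J}$ the corresponding marginals of $\mu$. Let $L>0$. The following are equivalent: (i) There exists a version of the conditional kernel $x_J\mapsto\mu(dx_I\mid x_J)$ which is $L$-Lipschitz with respect to total variation. (ii) $\mu_{I,J}\ll\mu_I\otimes\mu_J$, and the Radon–Nikodym derivative $f_{I,J}:=\frac{d\mu_{I,J}}{d(\mu_I\otimes\mu_J)}$ admits a version such that $x_J\mapsto f_{I,J}(\cdot,x_J)\in L^1(\mu_I)$ is $2L$-Lipschitz.
   Context: $\mathcal{X}=\mathcal{X}_1\times\dots\times\mathcal{X}_K$ with $\mathcal{X}_k=[0,1]^{d_k}$; for $I\subseteq\{1,\dots,K\}$, $\mathcal{X}_I=\prod_{i\in I}\mathcal{X}_i$ and $x_I=(x_i)_{i\in I}$. $\mathcal{P}(\mathcal{X})$ is the set of Borel probability measures on $\mathcal{X}$. $\|\cdot\|$ is the sup-norm. $\mathrm{TV}(\nu,\tilde\nu)=\sup_f\left(\int f\,d\nu-\int f\,d\tilde\nu\right)$, the supremum being over all measurable $f$ with $|f|\le 1/2$. $\mu(dx_I\mid x_J)$ is the regular conditional distribution of the $I$-coordinates given the $J$-coordinates under $\mu$. The maps in (i) and (ii) are defined on $\mathcal{X}_J$; that the kernel is $L$-Lipschitz with respect to total variation means $\mathrm{TV}(\mu(dx_I\mid x_J),\mu(dx_I\mid\tilde x_J))\le L\|x_J-\tilde x_J\|$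 for all $x_J,\tilde x_J\in\mathcal{X}_J$, and that the map in (ii) is $2L$-Lipschitz means $\|f_{I,J}(\cdot,x_J)-f_{I,J}(\cdot,\tilde x_J)\|_{L^1(\mu_I)}\le 2L\|x_J-\tilde x_J\|$ for all $x_J,\tilde x_J\in\mathcal{X}_J$.
   Formalization: In (ii) the version of f_{I,J} is required to be nonnegative with ∫ f_{I,J}(·,x_J) dμ_I = 1 for every x_J in X_J, not only μ_J-almost every x_J; without this, (ii) ⇒ (i) fails, e.g. for μ_J uniform on three points of [0,1]^2. *)

theory Defs
  imports "HOL-Probability.Probability"
begin

text \<open>
  A point \<open>x\<close> of \<open>[0,1]^(d k)\<close> is a function on \<open>{..<d k}\<close>, and a point of \<open>X_I\<close> is a function
  \<open>x\<close> with \<open>x k\<close> the block with index \<open>k \<in> I\<close> (both \<open>undefined\<close> outside their index set), so that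
  \<open>x_I\<close> is \<^term>\<open>restrict x I\<close>. The measurable sets of \<open>cubes d I\<close> are, for finite \<open>I\<close>, the Borel sets
  of the cube, because a finite product of second countable spaces carries the product of the Borel
  sigma algebras. The measure carried by \<open>cubes d I\<close> plays no role.
\<close>

definition cube :: "nat \<Rightarrow> (nat \<Rightarrow> real) measure" where
  "cube n = (\<Pi>\<^sub>M j\<in>{..<n}. restrict_space borel {0..1})"

definition cubes :: "(nat \<Rightarrow> nat) \<Rightarrow> nat set \<Rightarrow> (nat \<Rightarrow> nat \<Rightarrow> real) measure" where
  "cubes d I = (\<Pi>\<^sub>M k\<in>I. cube (d k))"

text \<open>The \<open>0\<close> is inserted only to give the zero-dimensional cube (all \<open>d k = 0\<close>) the norm \<open>0\<close>.\<close>

definition sup_norm :: "(nat \<Rightarrow> nat) \<Rightarrow> nat set \<Rightarrow> (nat \<Rightarrow> nat \<Rightarrow> real) \<Rightarrow> real" where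
  "sup_norm d I x = Max (insert 0 {\<bar>x k j\<bar> | k j. k \<in> I \<and> j < d k})"

definition tv :: "'a measure \<Rightarrow> 'a measure \<Rightarrow> real" where
  "tv M N = (SUP f \<in> {f \<in> borel_measurable M. \<forall>x\<in>space M. \<bar>f x\<bar> \<le> 1/2}.
     (\<integral>x. f x \<partial>M) - (\<integral>x. f x \<partial>N))"

definition marginal ::
  "(nat \<Rightarrow> nat) \<Rightarrow> (nat \<Rightarrow> nat \<Rightarrow> real) measure \<Rightarrow> nat set \<Rightarrow> (nat \<Rightarrow> nat \<Rightarrow> real) measure" where
  "marginal d \<mu> I = distr \<mu> (cubes d I) (\<lambda>x. restrict x I)"

definition joint_marginal ::
  "(nat \<Rightarrow> nat) \<Rightarrow> (nat \<Rightarrow> nat \<Rightarrow> real) measure \<Rightarrow> nat set \<Rightarrow> nat set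
    \<Rightarrow> ((nat \<Rightarrow> nat \<Rightarrow> real) \<times> (nat \<Rightarrow> nat \<Rightarrow> real)) measure" where
  "joint_marginal d \<mu> I J =
     distr \<mu> (cubes d I \<Otimes>\<^sub>M cubes d J) (\<lambda>x. (restrict x I, restrict x J))"

text \<open>\<open>\<kappa>\<close> is a version of the regular conditional distribution \<open>x_J \<mapsto> \<mu>(dx_I | x_J)\<close>.\<close>

definition is_cond_kernel ::
  "(nat \<Rightarrow> nat) \<Rightarrow> (nat \<Rightarrow> nat \<Rightarrow> real) measure \<Rightarrow> nat set \<Rightarrow> nat set
    \<Rightarrow> ((nat \<Rightarrow> nat \<Rightarrow> real) \<Rightarrow> (nat \<Rightarrow> nat \<Rightarrow> real) measure) \<Rightarrow> bool" where
  "is_cond_kernel d \<mu> I J \<kappa> \<longleftrightarrow>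
     \<kappa> \<in> cubes d J \<rightarrow>\<^sub>M prob_algebra (cubes d I) \<and>
     (\<forall>A\<in>sets (cubes d I). \<forall>B\<in>sets (cubes d J).
        emeasure (joint_marginal d \<mu> I J) (A \<times> B) = (\<integral>\<^sup>+y\<in>B. emeasure (\<kappa> y) A \<partial>marginal d \<mu> J))"

text \<open>
  \<open>f\<close> is a version of the Radon--Nikodym derivative of \<open>\<mu>_(I,J)\<close> with respect to \<open>\<mu>_I \<otimes> \<mu>_J\<close> that is a
  conditional density: every slice \<open>f(\<cdot>, x_J)\<close> is a probability density with respect to \<open>\<mu>_I\<close>. For
  \<open>\<mu>_J\<close>-almost every \<open>x_J\<close> this is automatic. It must be demanded at the remaining \<open>x_J\<close> too, as
  the Lipschitz condition is imposed on the whole cube and the almost everywhere equality says nothing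
  off the support of \<open>\<mu>_J\<close>. Otherwise let \<open>\<mu>_J\<close> be uniform on \<open>p_1 = (0,0)\<close>, \<open>p_2 = (1,0)\<close>,
  \<open>p_3 = (0,1)\<close>, and let the conditional laws at these points be uniform on three disjoint intervals
  \<open>A_j\<close> of length \<open>1/3\<close>. Then \<open>f(z, x) = 3 (\<Sum>j. indicator A_j z * max 0 (1 - 2 * dist x p_j))\<close>, with the
  sup-distance, is a nonnegative version that is 2-Lipschitz into \<open>L^1\<close>. But no version of the kernel
  is 1-Lipschitz in total variation, since its value at \<open>(1/2, 1/2)\<close> would give each \<open>A_j\<close> mass at
  least \<open>1/2\<close>.
\<close>

definition is_RN_version ::
  "(nat \<Rightarrow> nat) \<Rightarrow> (nat \<Rightarrow> nat \<Rightarrow> real) measure \<Rightarrow> nat set \<Rightarrow> nat set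
    \<Rightarrow> ((nat \<Rightarrow> nat \<Rightarrow> real) \<times> (nat \<Rightarrow> nat \<Rightarrow> real) \<Rightarrow> real) \<Rightarrow> bool" where
  "is_RN_version d \<mu> I J f \<longleftrightarrow>
     f \<in> borel_measurable (cubes d I \<Otimes>\<^sub>M cubes d J) \<and>
     (\<forall>z\<in>space (cubes d I \<Otimes>\<^sub>M cubes d J). 0 \<le> f z) \<and>
     (AE z in marginal d \<mu> I \<Otimes>\<^sub>M marginal d \<mu> J.
        ennreal (f z) = RN_deriv (marginal d \<mu> I \<Otimes>\<^sub>M marginal d \<mu> J) (joint_marginal d \<mu> I J) z) \<and>
     (\<forall>y\<in>space (cubes d J). integrable (marginal d \<mu> I) (\<lambda>x. f (x, y)) \<and>
        (\<integral>x. f (x, y) \<partial>marginal d \<mu> I) = 1)"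

end

(* For (ii) to (i), the slices of f are the densities of a kernel. For (i) to (ii), call the version
   \<kappa>. Away from the support of \<mu>_J the measure \<kappa> y may have a part singular to \<mu>_I. There is a single
   \<mu>_I-null set Z that carries the singular parts of \<kappa> y for y in a countable dense set, and hence for
   all y. Replacing \<kappa> y by its restriction to the complement of Z plus \<kappa> y Z times \<mu>_I does not increase
   total variation distances and changes nothing for \<mu>_J-almost every y, since \<mu>_I Z = 0. The densities
   of the new kernel at dyadic approximations of y converge almost everywhere, fast enough by the
   Lipschitz condition, and the limit is a jointly measurable density defined at every y. *)
theory Submission
  imports Defs
begin

section \<open>Null sets that carry singular parts\<close>

text \<open>The supremum of Q over the M-null sets is attained: the union Z of a maximizing sequence
  is still null. A null set A with mass outside Z would make \<open>A \<union> Z\<close> exceed this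
  supremum; finiteness of Q allows the mass of Z to be cancelled. Thus Z carries the part of Q that
  is singular to M.\<close>

lemma ex_null_set_absorbing:
  assumes "finite_measure Q" and sets_Q: "sets Q = sets M"
  shows "\<exists>Z\<in>null_sets M. \<forall>A\<in>null_sets M. emeasure Q (A - Z) = 0"
proof -
  interpret Q: finite_measure Q by fact
  have "null_sets M \<noteq> {}" by blast
  from ennreal_SUP_countable_SUP[OF this, of "emeasure Q"] obtain f :: "nat \<Rightarrow> ennreal"
    where f: "range f \<subseteq> emeasure Q ` null_sets M" "(SUP A\<in>null_sets M. emeasure Q A) = (SUP n. f n)"
    by auto
  then have "\<forall>n. \<exists>A\<in>null_sets M. f n = emeasure Q A"
    by blast
  then obtain B where B: "\<And>n. B n \<in> null_sets M" "\<And>n. f n = emeasure Q (B n)"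
    by metis
  define Z where "Z = (\<Union>n. B n)"
  have Z: "Z \<in> null_sets M"
    unfolding Z_def using B by auto
  have sup: "(SUP A\<in>null_sets M. emeasure Q A) \<le> emeasure Q Z"
    unfolding f(2) B(2) Z_def
    by (intro SUP_least emeasure_mono) (use B sets_Q in auto)
  have "emeasure Q (A - Z) = 0" if A: "A \<in> null_sets M" for A
  proof -
    have [measurable]: "A \<in> sets Q" "Z \<in> sets Q"
      using A Z sets_Q by auto
    have "emeasure Q Z + emeasure Q (A - Z) = emeasure Q (Z \<union> (A - Z))"
      by (intro plus_emeasure) auto
    also have "\<dots> = emeasure Q (A \<union> Z)"
      by (simp add: Un_commute)
    also have "\<dots> \<le> (SUP A\<in>null_sets M. emeasure Q A)"
      using A Z by (intro SUP_upper) auto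
    also note sup
    finally show ?thesis
      using Q.emeasure_finite[of Z] by (simp add: ennreal_add_left_cancel_le)
  qed
  with Z show ?thesis by blast
qed

section \<open>Spreading the mass of a null set\<close>

text \<open>This is the spreading of mass from Z seen through test functions: integrating
  \<open>average_on M Z g\<close> against Q is integrating g against the restriction of Q to the
  complement of Z plus \<open>Q Z\<close> times M. Stated for g instead of Q, the operation does not
  depend on Q and can be applied to all kernel values at once.\<close>

definition average_on :: "'a measure \<Rightarrow> 'a set \<Rightarrow> ('a \<Rightarrow> real) \<Rightarrow> 'a \<Rightarrow> real" where
  "average_on M Z g x = (if x \<in> Z then (\<integral>x. g x \<partial>M) else g x)"

lemma integrable_of_bounded:
  fixes g :: "'a \<Rightarrow> real"
  assumes "finite_measure M" "g \<in> borel_measurable M" "\<And>x. x \<in> space M \<Longrightarrow> \<bar>g x\<bar> \<le> B"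
  shows "integrable M g"
  using assms by (intro finite_measure.integrable_const_bound[where B=B]) auto

lemma integrable_mult_of_bounded:
  fixes u g :: "'a \<Rightarrow> real"
  assumes u: "integrable M u" and g: "g \<in> borel_measurable M" "\<And>x. x \<in> space M \<Longrightarrow> \<bar>g x\<bar> \<le> 1"
  shows "integrable M (\<lambda>x. u x * g x)"
proof (rule Bochner_Integration.integrable_bound[OF u])
  show "AE x in M. norm (u x * g x) \<le> norm (u x)"
    using g(2) by (intro AE_I2) (simp add: abs_mult mult_left_le)
qed (use u g in measurable)

lemma abs_integral_le_of_bounded:
  fixes g :: "'a \<Rightarrow> real"
  assumes "prob_space M" "g \<in> borel_measurable M" "\<And>x. x \<in> space M \<Longrightarrow> \<bar>g x\<bar> \<le> B"
  shows "\<bar>\<integral>x. g x \<partial>M\<bar> \<le> B"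
proof -
  interpret prob_space M by fact
  have g: "integrable M g"
    using assms by (intro integrable_of_bounded[where B=B]) (auto intro: finite_measure_axioms)
  have "\<bar>\<integral>x. g x \<partial>M\<bar> \<le> (\<integral>x. \<bar>g x\<bar> \<partial>M)"
    by (rule integral_abs_bound)
  also have "\<dots> \<le> B"
    using assms g by (intro integral_le_const) auto
  finally show ?thesis .
qed

text \<open>A mean under a probability measure obeys the same bound as the function. Test functions
  therefore go to admissible test functions, which is why spreading does not increase total
  variation distances.\<close>

lemma average_on_bounded:
  assumes "prob_space M" "g \<in> borel_measurable M" "\<And>x. x \<in> space M \<Longrightarrow> \<bar>g x\<bar> \<le> B" "x \<in> space M"
  shows "\<bar>average_on M Z g x\<bar> \<le> B"
  using assms abs_integral_le_of_bounded[OF assms(1-3)] by (simp add: average_on_def)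

lemma measurable_average_on [measurable]:
  assumes [measurable]: "g \<in> borel_measurable M" "Z \<in> sets M"
  shows "average_on M Z g \<in> borel_measurable M"
  unfolding average_on_def[abs_def] by measurable

text \<open>The density of \<open>Q|\<^bsub>-Z\<^esub> + Q Z \<cdot> M\<close>, the part of \<open>Q\<close> on the null set \<open>Z\<close> being spread over \<open>M\<close>.\<close>

lemma ex_spread_density:
  assumes "prob_space M" "prob_space Q" and sets_Q: "sets Q = sets M"
    and Z: "Z \<in> null_sets M" and abs: "\<And>A. A \<in> null_sets M \<Longrightarrow> emeasure Q (A - Z) = 0"
  shows "\<exists>h. h \<in> borel_measurable M \<and> (\<forall>x. 0 \<le> h x) \<and> integrable M h \<and>
    (\<forall>g\<in>borel_measurable M. (\<forall>x\<in>space M. \<bar>g x\<bar> \<le> 1) \<longrightarrow>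
      (\<integral>x. h x * g x \<partial>M) = (\<integral>x. average_on M Z g x \<partial>Q))"
proof -
  interpret M: prob_space M by fact
  interpret Q: prob_space Q by fact
  note [measurable_cong] = sets_Q
  have sp: "space Q = space M" by (rule sets_eq_imp_space_eq[OF sets_Q])
  have [measurable]: "Z \<in> sets M" using Z by auto
  \<comment> \<open>R is the part of Q off Z. The hypothesis \<open>abs\<close> says that it
    vanishes on M-null sets, so it has a finite-valued derivative D.\<close>
  define R where "R = density Q (\<lambda>x. ennreal (indicator (space M - Z) x))"
  have sR: "sets R = sets M" by (simp add: R_def sets_Q)
  have emR: "emeasure R A = emeasure Q (A - Z)" if [measurable]: "A \<in> sets M" for A
  proof -
    have "emeasure R A = (\<integral>\<^sup>+x. indicator (A - Z) x \<partial>Q)"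
    proof -
      have "emeasure R A = (\<integral>\<^sup>+x. ennreal (indicator (space M - Z) x) * indicator A x \<partial>Q)"
        unfolding R_def by (subst emeasure_density) auto
      also have "\<dots> = (\<integral>\<^sup>+x. indicator (A - Z) x \<partial>Q)"
        by (rule nn_integral_cong)
          (use sets.sets_into_space[OF that] in \<open>auto split: split_indicator\<close>)
      finally show ?thesis .
    qed
    then show ?thesis by simp
  qed
  have ac: "absolutely_continuous M R"
    unfolding absolutely_continuous_def
  proof
    fix A assume A: "A \<in> null_sets M"
    then show "A \<in> null_sets R"
      using emR[of A] abs[OF A] sR by auto
  qed
  have finR: "finite_measure R"
    by (rule finite_measureI) (use emR[of "space M"] sR sets_eq_imp_space_eq[OF sR] Q.emeasure_finite in auto)
  obtain D where D[measurable]: "D \<in> borel_measurable M"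
    and DR: "AE x in M. RN_deriv M R x = ennreal (D x)" and D0: "\<And>x. 0 \<le> D x"
    using M.real_RN_deriv[OF finR ac sR] by metis
  have "density M (\<lambda>x. ennreal (D x)) = density M (RN_deriv M R)"
    by (rule density_cong) (use DR in auto)
  also have "\<dots> = R"
    by (rule M.density_RN_deriv[OF ac sR])
  finally have R: "density M (\<lambda>x. ennreal (D x)) = R" .
  have D_eq: "(\<integral>x. D x * g x \<partial>M) = (\<integral>x. indicator (space M - Z) x * g x \<partial>Q)"
    if [measurable]: "g \<in> borel_measurable M" for g :: "'a \<Rightarrow> real"
  proof -
    have "(\<integral>x. D x * g x \<partial>M) = integral\<^sup>L R g"
      unfolding R[symmetric] using D0 by (subst integral_density) auto
    also have "\<dots> = (\<integral>x. indicator (space M - Z) x * g x \<partial>Q)"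
      unfolding R_def by (subst integral_density) auto
    finally show ?thesis .
  qed
  have intD: "integrable M D"
  proof (rule integrableI_nonneg)
    have "(\<integral>\<^sup>+x. ennreal (D x) \<partial>M) = emeasure (density M (\<lambda>x. ennreal (D x))) (space M)"
      by (subst emeasure_density) (auto intro!: nn_integral_cong)
    also have "\<dots> < \<infinity>"
      unfolding R using finite_measure.emeasure_finite[OF finR] by (simp add: less_top[symmetric])
    finally show "(\<integral>\<^sup>+x. ennreal (D x) \<partial>M) < \<infinity>" .
  qed (use D0 in auto)
  \<comment> \<open>The constant \<open>measure Q Z\<close> is the density of the mass of Z once it
    is spread over M.\<close>
  define h where "h x = D x + measure Q Z" for x
  have [measurable]: "h \<in> borel_measurable M" unfolding h_def by measurable
  have "(\<integral>x. h x * g x \<partial>M) = (\<integral>x. average_on M Z g x \<partial>Q)"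
    if [measurable]: "g \<in> borel_measurable M" and g: "\<forall>x\<in>space M. \<bar>g x\<bar> \<le> 1" for g
  proof -
    have intg: "integrable M g"
      using g by (intro integrable_of_bounded[where B=1] M.finite_measure_axioms) auto
    have intg': "integrable M (\<lambda>x. D x * g x)"
      using g by (intro integrable_mult_of_bounded intD) auto
    have i1: "integrable Q (\<lambda>x. indicator (space M - Z) x * g x)"
      using g by (intro integrable_of_bounded[where B=1] Q.finite_measure_axioms)
        (auto simp: sp split: split_indicator)
    have "(\<integral>x. h x * g x \<partial>M) = (\<integral>x. D x * g x \<partial>M) + measure Q Z * (\<integral>x. g x \<partial>M)"
      unfolding h_def distrib_right using intg intg' by simp
    also have "\<dots> = (\<integral>x. indicator (space M - Z) x * g x \<partial>Q) + (\<integral>x. indicator Z x * (\<integral>x. g x \<partial>M) \<partial>Q)"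
      using sets.sets_into_space[OF \<open>Z \<in> sets M\<close>] by (simp add: D_eq Int_absorb2 sp)
    also have "\<dots> = (\<integral>x. indicator (space M - Z) x * g x + indicator Z x * (\<integral>x. g x \<partial>M) \<partial>Q)"
      using i1 by (subst Bochner_Integration.integral_add) (auto simp: less_top[symmetric])
    also have "\<dots> = (\<integral>x. average_on M Z g x \<partial>Q)"
      by (intro Bochner_Integration.integral_cong)
        (auto simp: average_on_def sp split: split_indicator)
    finally show ?thesis .
  qed
  moreover have "integrable M h" "\<forall>x. 0 \<le> h x"
    using intD D0 by (auto simp: h_def[abs_def])
  ultimately show ?thesis by (intro exI[of _ h]) auto
qed

section \<open>Total variation and L1 distances\<close>

text \<open>As a supremum of reals, \<open>tv\<close> dominates its members once they are bounded
  above. Integrals of test functions against probability measures lie between -1/2 and 1/2, so 1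
  bounds every difference.\<close>

lemma tv_upper:
  fixes g :: "'a \<Rightarrow> real"
  assumes "prob_space Q" "prob_space Q'" and sets: "sets Q = sets Q'"
    and g: "g \<in> borel_measurable Q" "\<And>x. x \<in> space Q \<Longrightarrow> \<bar>g x\<bar> \<le> 1/2"
  shows "(\<integral>x. g x \<partial>Q) - (\<integral>x. g x \<partial>Q') \<le> tv Q Q'"
  unfolding tv_def
proof (rule cSUP_upper2[OF _ _ order_refl])
  have b: "(\<integral>x. f x \<partial>Q) - (\<integral>x. f x \<partial>Q') \<le> 1"
    if "f \<in> borel_measurable Q" "\<And>x. x \<in> space Q \<Longrightarrow> \<bar>f x\<bar> \<le> 1/2" for f :: "'a \<Rightarrow> real"
  proof -
    have f': "f \<in> borel_measurable Q'" "\<And>x. x \<in> space Q' \<Longrightarrow> \<bar>f x\<bar> \<le> 1/2"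
      using that sets sets_eq_imp_space_eq[OF sets] by (auto cong: measurable_cong_sets)
    show ?thesis
      using abs_integral_le_of_bounded[OF assms(1) that] abs_integral_le_of_bounded[OF assms(2) f']
      by (simp add: abs_le_iff)
  qed
  show "bdd_above ((\<lambda>f. (\<integral>x. f x \<partial>Q) - (\<integral>x. f x \<partial>Q')) `
     {f \<in> borel_measurable Q. \<forall>x\<in>space Q. \<bar>f x\<bar> \<le> (1/2 :: real)})"
    by (rule bdd_aboveI2[where M=1]) (use b in auto)
qed (use g in auto)

text \<open>The sign of \<open>h - h'\<close> is the test function that recovers the L1 distance.
  Its average over Z still has values in [-1, 1], so half of it is admissible in \<open>tv\<close>;
  undoing the halving gives the factor 2, which is the factor between the two Lipschitz
  constants.\<close>

lemma L1_dist_le_tv: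
  assumes M: "prob_space M" and Q: "prob_space Q" "prob_space Q'" "sets Q = sets M" "sets Q' = sets M"
    and Z[measurable]: "Z \<in> sets M"
    and h: "integrable M h" "integrable M h'"
    and eq: "\<And>g. g \<in> borel_measurable M \<Longrightarrow> (\<And>x. x \<in> space M \<Longrightarrow> \<bar>g x\<bar> \<le> 1) \<Longrightarrow>
      (\<integral>x. h x * g x \<partial>M) = (\<integral>x. average_on M Z g x \<partial>Q)"
    and eq': "\<And>g. g \<in> borel_measurable M \<Longrightarrow> (\<And>x. x \<in> space M \<Longrightarrow> \<bar>g x\<bar> \<le> 1) \<Longrightarrow>
      (\<integral>x. h' x * g x \<partial>M) = (\<integral>x. average_on M Z g x \<partial>Q')"
  shows "(\<integral>x. \<bar>h x - h' x\<bar> \<partial>M) \<le> 2 * tv Q Q'"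
proof -
  have [measurable]: "h \<in> borel_measurable M" "h' \<in> borel_measurable M" using h by auto
  define g where "g x = sgn (h x - h' x)" for x
  have [measurable]: "g \<in> borel_measurable M" unfolding g_def by measurable
  have g: "\<bar>g x\<bar> \<le> 1" for x by (simp add: g_def sgn_if)
  have i: "integrable M (\<lambda>x. h x * g x)" "integrable M (\<lambda>x. h' x * g x)"
    using g by (intro integrable_mult_of_bounded h; simp)+
  have "(\<integral>x. \<bar>h x - h' x\<bar> \<partial>M) = (\<integral>x. h x * g x - h' x * g x \<partial>M)"
    by (intro Bochner_Integration.integral_cong) (auto simp: g_def sgn_if)
  also have "\<dots> = (\<integral>x. average_on M Z g x \<partial>Q) - (\<integral>x. average_on M Z g x \<partial>Q')"
    using i g by (simp add: eq eq')
  also have "\<dots> = 2 * ((\<integral>x. average_on M Z g x / 2 \<partial>Q) - (\<integral>x. average_on M Z g x / 2 \<partial>Q'))"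
    by simp
  also have "\<dots> \<le> 2 * tv Q Q'"
  proof (intro mult_left_mono tv_upper)
    show "(\<lambda>x. average_on M Z g x / 2) \<in> borel_measurable Q"
      unfolding measurable_cong_sets[OF Q(3) refl] by measurable
    show "\<bar>average_on M Z g x / 2\<bar> \<le> 1/2" if "x \<in> space Q" for x
      using average_on_bounded[OF M \<open>g \<in> borel_measurable M\<close> g, of x Z] that
        sets_eq_imp_space_eq[OF Q(3)] by simp
  qed (use Q in auto)
  finally show ?thesis .
qed

text \<open>The supremum in \<open>tv\<close> is over signed differences, so the absolute value is
  reached by testing with both \<open>g / 2\<close> and \<open>- g / 2\<close>.\<close>

lemma abs_integral_diff_le_tv:
  assumes Q: "prob_space Q" "prob_space Q'" "sets Q = sets Q'"
    and g: "g \<in> borel_measurable Q" "\<And>x. x \<in> space Q \<Longrightarrow> \<bar>g x\<bar> \<le> 1"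
  shows "\<bar>(\<integral>x. g x \<partial>Q) - (\<integral>x. g x \<partial>Q')\<bar> \<le> 2 * tv Q Q'"
  using tv_upper[OF Q, of "\<lambda>x. g x / 2"] tv_upper[OF Q, of "\<lambda>x. - g x / 2"] g by simp

section \<open>Jointly measurable densities\<close>

text \<open>
  The densities of the countably many kernels \<open>\<kappa> i\<close>, \<open>i \<in> D\<close>, are combined along \<open>i = r n y\<close>. Since the
  \<open>L\<^sup>1\<close>-distances of consecutive densities are summable, they converge almost everywhere for every \<open>y\<close>.
\<close>

lemma ex_jointly_measurable_density:
  fixes M :: "'a measure" and T :: "'b measure" and e :: "nat \<Rightarrow> real"
  assumes M: "prob_space M"
    and \<kappa>: "\<And>y. y \<in> space T \<Longrightarrow> prob_space (\<kappa> y)" "\<And>y. y \<in> space T \<Longrightarrow> sets (\<kappa> y) = sets M"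
    and D: "countable D" "D \<subseteq> space T"
    and r: "\<And>n. r n \<in> T \<rightarrow>\<^sub>M count_space D"
    and e: "summable e" "\<And>n y. y \<in> space T \<Longrightarrow> tv (\<kappa> (r (Suc n) y)) (\<kappa> (r n y)) \<le> e n"
    and lim: "\<And>y. y \<in> space T \<Longrightarrow> (\<lambda>n. tv (\<kappa> (r n y)) (\<kappa> y)) \<longlonglongrightarrow> 0"
  shows "\<exists>Z\<in>null_sets M. \<exists>f\<in>borel_measurable (M \<Otimes>\<^sub>M T). (\<forall>z. 0 \<le> f z) \<and>
    (\<forall>y\<in>space T. integrable M (\<lambda>x. f (x, y)) \<and>
      (\<forall>g\<in>borel_measurable M. (\<forall>x\<in>space M. \<bar>g x\<bar> \<le> 1) \<longrightarrow>
        (\<integral>x. f (x, y) * g x \<partial>M) = (\<integral>x. average_on M Z g x \<partial>\<kappa> y)))"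
proof -
  interpret M: prob_space M by fact
  have "\<exists>Z. Z \<in> null_sets M \<and> (\<forall>A\<in>null_sets M. emeasure (\<kappa> i) (A - Z) = 0)" if "i \<in> D" for i
    using ex_null_set_absorbing[of "\<kappa> i" M] \<kappa>[of i] D that
    by (auto simp: prob_space.finite_measure Bex_def)
  then obtain Z' where Z': "\<And>i. i \<in> D \<Longrightarrow> Z' i \<in> null_sets M"
    "\<And>i A. i \<in> D \<Longrightarrow> A \<in> null_sets M \<Longrightarrow> emeasure (\<kappa> i) (A - Z' i) = 0"
    by metis
  \<comment> \<open>Countability of D keeps the union null. With one common Z all densities refer to
    the same averaging, so that they can be compared in L1.\<close>
  define Z where "Z = (\<Union>i\<in>D. Z' i)"
  have Z: "Z \<in> null_sets M"
    unfolding Z_def using Z'(1) D(1) by (intro null_sets_UN')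
  then have [measurable]: "Z \<in> sets M" by auto
  have absorb: "emeasure (\<kappa> i) (A - Z) = 0" if "i \<in> D" "A \<in> null_sets M" for i A
  proof -
    have "emeasure (\<kappa> i) (A - Z) \<le> emeasure (\<kappa> i) (A - Z' i)"
      using that Z' \<kappa>[of i] D by (intro emeasure_mono) (auto simp: Z_def)
    then show ?thesis using Z'(2)[OF that] by simp
  qed
  \<comment> \<open>\<open>good i h\<close> says that h is a density of \<open>\<kappa> i\<close>
    after its mass on Z has been spread over M.\<close>
  define good where "good i h \<longleftrightarrow> h \<in> borel_measurable M \<and> (\<forall>x. 0 \<le> h x) \<and> integrable M h \<and>
    (\<forall>g\<in>borel_measurable M. (\<forall>x\<in>space M. \<bar>g x\<bar> \<le> 1) \<longrightarrow>
      (\<integral>x. h x * g x \<partial>M) = (\<integral>x. average_on M Z g x \<partial>\<kappa> i))" for i h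
  have "\<exists>h. good i h" if "i \<in> D" for i
  proof -
    have "i \<in> space T" using that D by auto
    then show ?thesis
      unfolding good_def by (intro ex_spread_density M \<kappa> Z absorb that)
  qed
  then obtain h where h: "\<And>i. i \<in> D \<Longrightarrow> good i (h i)"
    by metis
  have h_meas [measurable]: "h i \<in> borel_measurable M"
    and h0: "0 \<le> h i x"
    and h_int: "integrable M (h i)" if "i \<in> D" for i x
    using h[OF that] by (auto simp: good_def)
  have h_eq: "(\<integral>x. h i x * g x \<partial>M) = (\<integral>x. average_on M Z g x \<partial>\<kappa> i)"
    if "i \<in> D" "g \<in> borel_measurable M" "\<And>x. x \<in> space M \<Longrightarrow> \<bar>g x\<bar> \<le> 1" for i g
    using h[OF that(1)] that(2,3) unfolding good_def by blast
  have rD: "r n y \<in> D" if "y \<in> space T" for n y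
    using measurable_space[OF r that] by simp
  then have rT: "r n y \<in> space T" if "y \<in> space T" for n y
    using that D by auto
  \<comment> \<open>Each \<open>h i\<close> is measurable in x alone. Joint measurability follows
    because \<open>r n\<close> takes values in the countable set D, and on each of its level sets a
    single \<open>h i\<close> is used.\<close>
  have [measurable]: "(\<lambda>z. h (r n (snd z)) (fst z)) \<in> borel_measurable (M \<Otimes>\<^sub>M T)" for n
  proof (rule measurable_compose_countable'[where f="\<lambda>i z. h i (fst z)" and g="\<lambda>z. r n (snd z)", OF _ _ D(1)])
    show "(\<lambda>z. h i (fst z)) \<in> borel_measurable (M \<Otimes>\<^sub>M T)" if "i \<in> D" for i
      using h_meas[OF that] by measurable
    show "(\<lambda>z. r n (snd z)) \<in> M \<Otimes>\<^sub>M T \<rightarrow>\<^sub>M count_space D"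
      using r by measurable
  qed
  \<comment> \<open>Where the densities diverge, \<open>lim\<close> has an unspecified value; the
    maximum with 0 makes f nonnegative there too. Where they converge it changes nothing, the limit
    of nonnegative numbers being nonnegative.\<close>
  define f where "f z = max 0 (lim (\<lambda>n. h (r n (snd z)) (fst z)))" for z
  have [measurable]: "f \<in> borel_measurable (M \<Otimes>\<^sub>M T)"
    unfolding f_def by measurable
  have "integrable M (\<lambda>x. f (x, y)) \<and>
      (\<forall>g\<in>borel_measurable M. (\<forall>x\<in>space M. \<bar>g x\<bar> \<le> 1) \<longrightarrow>
        (\<integral>x. f (x, y) * g x \<partial>M) = (\<integral>x. average_on M Z g x \<partial>\<kappa> y))" if y: "y \<in> space T" for y
  proof -
    define H where "H n = h (r n y)" for n
    have H_int: "integrable M (H n)" and H0: "0 \<le> H n x" for n x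
      using rD[OF y] h_int h0 by (auto simp: H_def)
    then have [measurable]: "\<And>n. H n \<in> borel_measurable M" by auto
    \<comment> \<open>\<open>H n\<close> is \<open>H 0\<close> plus a sum of increments, and the L1
      norm of \<open>F n\<close> is at most \<open>2 * e n\<close>. Hence the sum of the norms has
      finite integral, and the series of increments converges absolutely almost everywhere.\<close>
    define F where "F n x = H (Suc n) x - H n x" for n x
    have F_int: "integrable M (F n)" for n
      unfolding F_def[abs_def] using H_int by simp
    then have [measurable]: "\<And>n. F n \<in> borel_measurable M" by auto
    have FL: "(\<integral>x. norm (F n x) \<partial>M) \<le> 2 * e n" for n
    proof -
      have "(\<integral>x. \<bar>H (Suc n) x - H n x\<bar> \<partial>M) \<le> 2 * tv (\<kappa> (r (Suc n) y)) (\<kappa> (r n y))"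
        using rD[OF y] \<kappa>[OF rT[OF y]] H_int unfolding H_def
        by (intro L1_dist_le_tv[where Z=Z] M h_eq) auto
      also have "\<dots> \<le> 2 * e n" using e(2)[OF y] by simp
      finally show ?thesis by (simp add: F_def)
    qed
    have sums: "summable (\<lambda>n. \<integral>x. norm (F n x) \<partial>M)"
      by (rule summable_comparison_test'[where g="\<lambda>n. 2 * e n"])
        (use FL e(1) in \<open>auto simp: summable_mult\<close>)
    have "(\<integral>\<^sup>+x. (\<Sum>n. ennreal (norm (F n x))) \<partial>M) = (\<Sum>n. ennreal (\<integral>x. norm (F n x) \<partial>M))"
      using F_int by (subst nn_integral_suminf) (auto intro!: suminf_cong nn_integral_eq_integral)
    also have "\<dots> \<noteq> \<infinity>"
      using sums by (simp add: ennreal_suminf_neq_top)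
    finally have "AE x in M. (\<Sum>n. ennreal (norm (F n x))) \<noteq> \<infinity>"
      by (intro nn_integral_PInf_AE) auto
    then have AE_sum: "AE x in M. summable (\<lambda>n. norm (F n x))"
    proof eventually_elim
      case (elim x)
      then show ?case
        unfolding infinity_ennreal_def by (rule summable_suminf_not_top[OF norm_ge_zero])
    qed
    have AE_f: "AE x in M. f (x, y) = H 0 x + (\<Sum>n. F n x)"
      using AE_sum
    proof eventually_elim
      case (elim x)
      then have "(\<lambda>n. \<Sum>i<n. F i x) \<longlonglongrightarrow> (\<Sum>n. F n x)"
        by (rule summable_LIMSEQ[OF summable_norm_cancel])
      then have "(\<lambda>n. H 0 x + (\<Sum>i<n. F i x)) \<longlonglongrightarrow> H 0 x + (\<Sum>n. F n x)"
        by (intro tendsto_intros)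
      moreover have "H 0 x + (\<Sum>i<n. F i x) = H n x" for n
        unfolding F_def by (subst sum_lessThan_telescope) simp
      ultimately have *: "(\<lambda>n. H n x) \<longlonglongrightarrow> H 0 x + (\<Sum>n. F n x)" by simp
      then have "0 \<le> H 0 x + (\<Sum>n. F n x)"
        by (rule LIMSEQ_le_const) (use H0 in auto)
      then show ?case
        using limI[OF *] by (simp add: f_def H_def[symmetric])
    qed
    have fy [measurable]: "(\<lambda>x. f (x, y)) \<in> borel_measurable M"
      using y by measurable
    have G_int: "integrable M (\<lambda>x. H 0 x + (\<Sum>n. F n x))"
      using H_int integrable_suminf[OF F_int AE_sum sums] by simp
    have f_int: "integrable M (\<lambda>x. f (x, y))"
      using integrable_cong_AE[THEN iffD2, OF _ _ AE_f G_int] G_int by auto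
    moreover have "(\<integral>x. f (x, y) * g x \<partial>M) = (\<integral>x. average_on M Z g x \<partial>\<kappa> y)"
      if [measurable]: "g \<in> borel_measurable M" and g: "\<forall>x\<in>space M. \<bar>g x\<bar> \<le> 1" for g
    proof -
      \<comment> \<open>The series of \<open>a (Suc n) - a n\<close> is summed in two ways. By
        convergence in total variation it telescopes to the integral against
        \<open>\<kappa> y\<close> minus \<open>a 0\<close>. By exchanging sum and integral it is the
        integral of the series of \<open>F n x * g x\<close>.\<close>
      define a where "a n = (\<integral>x. average_on M Z g x \<partial>\<kappa> (r n y))" for n
      have a: "(\<integral>x. H n x * g x \<partial>M) = a n" for n
        unfolding H_def a_def using rD[OF y] g by (intro h_eq) auto
      have mul_int: "integrable M (\<lambda>x. u x * g x)" if "integrable M u" for u :: "'a \<Rightarrow> real"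
        using g by (intro integrable_mult_of_bounded that) auto
      have dist: "norm (a n - (\<integral>x. average_on M Z g x \<partial>\<kappa> y)) \<le> 2 * tv (\<kappa> (r n y)) (\<kappa> y)" for n
      proof -
        note n = rT[OF y, of n]
        have "average_on M Z g \<in> borel_measurable (\<kappa> (r n y))"
          unfolding measurable_cong_sets[OF \<kappa>(2)[OF n] refl] by measurable
        then show ?thesis
          unfolding a_def real_norm_def
          using \<kappa>(1)[OF n] \<kappa>(1)[OF y] \<kappa>(2)[OF n] \<kappa>(2)[OF y] g
          by (intro abs_integral_diff_le_tv average_on_bounded[OF M])
            (auto dest: sets_eq_imp_space_eq)
      qed
      have "(\<lambda>n. 2 * tv (\<kappa> (r n y)) (\<kappa> y)) \<longlonglongrightarrow> 0"
        using tendsto_mult_right_zero[OF lim[OF y], of 2] by simp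
      then have "(\<lambda>n. a n - (\<integral>x. average_on M Z g x \<partial>\<kappa> y)) \<longlonglongrightarrow> 0"
        by (rule Lim_null_comparison[rotated]) (use dist in auto)
      then have "a \<longlonglongrightarrow> (\<integral>x. average_on M Z g x \<partial>\<kappa> y)"
        by (simp add: LIM_zero_iff)
      then have s1: "(\<lambda>n. a (Suc n) - a n) sums ((\<integral>x. average_on M Z g x \<partial>\<kappa> y) - a 0)"
        by (rule telescope_sums)
      have Fa: "(\<integral>x. F n x * g x \<partial>M) = a (Suc n) - a n" for n
        unfolding F_def left_diff_distrib using mul_int[OF H_int] by (simp add: a)
      have AE_sum': "AE x in M. summable (\<lambda>n. norm (F n x * g x))"
        using AE_sum by eventually_elim (auto simp: abs_mult intro: summable_mult2)
      have "norm (\<integral>x. norm (F n x * g x) \<partial>M) \<le> (\<integral>x. norm (F n x) \<partial>M)" for n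
      proof -
        have "(\<integral>x. norm (F n x * g x) \<partial>M) \<le> (\<integral>x. norm (F n x) \<partial>M)"
          using F_int[of n] mul_int[OF F_int[of n]] g
          by (intro integral_mono integrable_norm) (auto simp: abs_mult intro!: mult_left_le)
        then show ?thesis by simp
      qed
      then have sums': "summable (\<lambda>n. \<integral>x. norm (F n x * g x) \<partial>M)"
        by (intro summable_comparison_test'[OF sums]) auto
      have s2: "(\<lambda>n. a (Suc n) - a n) sums (\<integral>x. (\<Sum>n. F n x * g x) \<partial>M)"
        using sums_integral[OF mul_int[OF F_int] AE_sum' sums'] by (simp add: Fa)
      have "(\<integral>x. f (x, y) * g x \<partial>M) = (\<integral>x. H 0 x * g x + (\<Sum>n. F n x * g x) \<partial>M)"
      proof (rule integral_cong_AE)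
        show "AE x in M. f (x, y) * g x = H 0 x * g x + (\<Sum>n. F n x * g x)"
          using AE_f AE_sum
        proof eventually_elim
          case (elim x)
          then show ?case
            using suminf_mult2[OF summable_norm_cancel[OF elim(2)], of "g x"]
            by (simp add: distrib_right)
        qed
      qed measurable
      also have "\<dots> = a 0 + (\<integral>x. (\<Sum>n. F n x * g x) \<partial>M)"
        using mul_int[OF H_int] integrable_suminf[OF mul_int[OF F_int] AE_sum' sums']
        by (subst Bochner_Integration.integral_add) (auto simp: a)
      also have "(\<integral>x. (\<Sum>n. F n x * g x) \<partial>M) = (\<integral>x. average_on M Z g x \<partial>\<kappa> y) - a 0"
        by (rule sums_unique2[OF s2 s1])
      finally show ?thesis by simp
    qed
    ultimately show ?thesis by blast
  qed
  then show ?thesis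
    using Z by (intro bexI[of _ Z] bexI[of _ f]) (auto simp: f_def[abs_def])
qed

section \<open>Laws on a product and measures with a density\<close>

text \<open>Measurable rectangles are stable under intersection, generate the product sigma algebra
  and include the whole space, so they determine a finite measure.\<close>

lemma finite_pair_measure_eqI:
  assumes P: "sets P = sets (M \<Otimes>\<^sub>M N)" "finite_measure P" and R: "sets R = sets (M \<Otimes>\<^sub>M N)"
    and eq: "\<And>A B. A \<in> sets M \<Longrightarrow> B \<in> sets N \<Longrightarrow> emeasure P (A \<times> B) = emeasure R (A \<times> B)"
  shows "P = R"
proof (rule measure_eqI_generator_eq[OF Int_stable_pair_measure_generator[of M N],
      where \<Omega>="space M \<times> space N" and A="\<lambda>_. space M \<times> space N"])
  show "{a \<times> b |a b. a \<in> sets M \<and> b \<in> sets N} \<subseteq> Pow (space M \<times> space N)"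
    using sets.space_closed[of M] sets.space_closed[of N] by auto
  show "emeasure P (space M \<times> space N) \<noteq> \<infinity>"
    using finite_measure.emeasure_finite[OF P(2)] by simp
qed (use P R eq in \<open>auto simp: sets_pair_measure\<close>)

text \<open>Tonelli, with the conditioning coordinate y outside, to match the formula that defines a
  conditional kernel.\<close>

lemma emeasure_density_Times:
  assumes "sigma_finite_measure M" "sigma_finite_measure N"
    and [measurable]: "f \<in> borel_measurable (M \<Otimes>\<^sub>M N)" "A \<in> sets M" "B \<in> sets N"
  shows "emeasure (density (M \<Otimes>\<^sub>M N) f) (A \<times> B) = (\<integral>\<^sup>+y\<in>B. (\<integral>\<^sup>+x\<in>A. f (x, y) \<partial>M) \<partial>N)"
proof -
  interpret M: sigma_finite_measure M by fact
  interpret N: sigma_finite_measure N by fact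
  interpret pair_sigma_finite M N ..
  have "emeasure (density (M \<Otimes>\<^sub>M N) f) (A \<times> B) = (\<integral>\<^sup>+z. f z * indicator (A \<times> B) z \<partial>(M \<Otimes>\<^sub>M N))"
    by (subst emeasure_density) auto
  also have "\<dots> = (\<integral>\<^sup>+y. (\<integral>\<^sup>+x. f (x, y) * indicator (A \<times> B) (x, y) \<partial>M) \<partial>N)"
    by (rule nn_integral_snd[symmetric]) measurable
  also have "\<dots> = (\<integral>\<^sup>+y\<in>B. (\<integral>\<^sup>+x\<in>A. f (x, y) \<partial>M) \<partial>N)"
    by (intro nn_integral_cong) (auto simp: indicator_times split: split_indicator)
  finally show ?thesis .
qed

text \<open>Since M is the first marginal of P, integrating \<open>emeasure (\<kappa> y) Z\<close>
  over N gives the M-measure of Z, which is 0. So almost every \<open>\<kappa> y\<close> does not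
  charge Z; for such y averaging over Z is invisible to \<open>\<kappa> y\<close>, and the slice of
  f at y is a genuine density of \<open>\<kappa> y\<close>. The other y do not contribute to the
  mass of rectangles.\<close>

lemma density_eq_of_kernel:
  assumes M: "prob_space M" and N: "prob_space N"
    and \<kappa>: "\<And>y. y \<in> space N \<Longrightarrow> prob_space (\<kappa> y)" "\<And>y. y \<in> space N \<Longrightarrow> sets (\<kappa> y) = sets M"
    and \<kappa>_meas: "\<And>A. A \<in> sets M \<Longrightarrow> (\<lambda>y. emeasure (\<kappa> y) A) \<in> borel_measurable N"
    and P: "sets P = sets (M \<Otimes>\<^sub>M N)" "finite_measure P"
    and P_eq: "\<And>A B. A \<in> sets M \<Longrightarrow> B \<in> sets N \<Longrightarrow>
      emeasure P (A \<times> B) = (\<integral>\<^sup>+y\<in>B. emeasure (\<kappa> y) A \<partial>N)"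
    and M_eq: "\<And>A. A \<in> sets M \<Longrightarrow> emeasure M A = emeasure P (A \<times> space N)"
    and Z: "Z \<in> null_sets M"
    and f [measurable]: "f \<in> borel_measurable (M \<Otimes>\<^sub>M N)" and f0: "\<And>z. 0 \<le> f z"
    and f_int: "\<And>y. y \<in> space N \<Longrightarrow> integrable M (\<lambda>x. f (x, y))"
    and f_eq: "\<And>y g. y \<in> space N \<Longrightarrow> g \<in> borel_measurable M \<Longrightarrow> (\<And>x. x \<in> space M \<Longrightarrow> \<bar>g x\<bar> \<le> 1) \<Longrightarrow>
      (\<integral>x. f (x, y) * g x \<partial>M) = (\<integral>x. average_on M Z g x \<partial>\<kappa> y)"
  shows "P = density (M \<Otimes>\<^sub>M N) (\<lambda>z. ennreal (f z))"
proof (rule finite_pair_measure_eqI[OF P])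
  interpret M: prob_space M by fact
  interpret N: prob_space N by fact
  have Zs [measurable]: "Z \<in> sets M" using Z by auto
  have "(\<integral>\<^sup>+y. emeasure (\<kappa> y) Z \<partial>N) = emeasure M Z"
    unfolding M_eq[OF Zs] P_eq[OF Zs sets.top] by (auto intro!: nn_integral_cong)
  also have "\<dots> = 0" using Z by auto
  finally have AE_Z: "AE y in N. emeasure (\<kappa> y) Z = 0"
    by (subst (asm) nn_integral_0_iff_AE) (use \<kappa>_meas Zs in auto)
  fix A B assume A [measurable]: "A \<in> sets M" and B [measurable]: "B \<in> sets N"
  have "emeasure P (A \<times> B) = (\<integral>\<^sup>+y\<in>B. emeasure (\<kappa> y) A \<partial>N)"
    by (rule P_eq) fact+
  also have "\<dots> = (\<integral>\<^sup>+y\<in>B. (\<integral>\<^sup>+x\<in>A. ennreal (f (x, y)) \<partial>M) \<partial>N)"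
  proof (rule nn_integral_cong_AE)
    show "AE y in N. emeasure (\<kappa> y) A * indicator B y =
        (\<integral>\<^sup>+x\<in>A. ennreal (f (x, y)) \<partial>M) * indicator B y"
      using AE_Z AE_space
    proof eventually_elim
      case (elim y)
      interpret k: prob_space "\<kappa> y" using \<kappa> elim by auto
      have [measurable]: "A \<in> sets (\<kappa> y)" "Z \<in> sets (\<kappa> y)" using \<kappa> elim by auto
      have [measurable]: "(\<lambda>x. f (x, y)) \<in> borel_measurable M" using elim by measurable
      have "AE x in \<kappa> y. x \<notin> Z"
        using elim \<open>Z \<in> sets (\<kappa> y)\<close> by (intro AE_not_in) auto
      have "measure (\<kappa> y) A = (\<integral>x. indicator A x \<partial>\<kappa> y)"
        by simp
      also have "\<dots> = (\<integral>x. average_on M Z (indicator A) x \<partial>\<kappa> y)"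
      proof (rule integral_cong_AE)
        show "average_on M Z (indicator A) \<in> borel_measurable (\<kappa> y)"
          unfolding measurable_cong_sets[OF \<kappa>(2)[OF elim(2)] refl] by measurable
        show "AE x in \<kappa> y. indicator A x = average_on M Z (indicator A) x"
          using \<open>AE x in \<kappa> y. x \<notin> Z\<close> by eventually_elim (simp add: average_on_def)
      qed measurable
      also have "\<dots> = (\<integral>x. f (x, y) * indicator A x \<partial>M)"
        using elim by (intro f_eq[symmetric]) (auto split: split_indicator)
      finally have "emeasure (\<kappa> y) A = ennreal (\<integral>x. f (x, y) * indicator A x \<partial>M)"
        by (simp add: k.emeasure_eq_measure)
      also have "\<dots> = (\<integral>\<^sup>+x. ennreal (f (x, y) * indicator A x) \<partial>M)"
        using f_int[OF elim(2)] f0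
        by (intro nn_integral_eq_integral[symmetric] integrable_real_mult_indicator) auto
      finally show ?case
        by (auto split: split_indicator intro!: nn_integral_cong)
    qed
  qed
  also have "\<dots> = emeasure (density (M \<Otimes>\<^sub>M N) (\<lambda>z. ennreal (f z))) (A \<times> B)"
    by (rule emeasure_density_Times[symmetric]) (auto intro: M.sigma_finite_measure_axioms N.sigma_finite_measure_axioms)
  finally show "emeasure P (A \<times> B) = emeasure (density (M \<Otimes>\<^sub>M N) (\<lambda>z. ennreal (f z))) (A \<times> B)" .
qed simp

text \<open>Each difference of integrals is the integral of \<open>(h x - h' x) * g x\<close>
  against M, and the bound 1/2 on g gives the factor 1/2. The zero function makes the set of test
  functions non-empty, as a supremum of reals requires.\<close>

lemma tv_density_le:
  assumes h: "integrable M h" "integrable M h'" "\<And>x. x \<in> space M \<Longrightarrow> 0 \<le> h x" "\<And>x. x \<in> space M \<Longrightarrow> 0 \<le> h' x"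
  shows "tv (density M (\<lambda>x. ennreal (h x))) (density M (\<lambda>x. ennreal (h' x))) \<le> (\<integral>x. \<bar>h x - h' x\<bar> \<partial>M) / 2"
  unfolding tv_def
proof (rule cSUP_least)
  have "(\<lambda>_. 0) \<in> {f \<in> borel_measurable (density M (\<lambda>x. ennreal (h x))).
      \<forall>x\<in>space (density M (\<lambda>x. ennreal (h x))). \<bar>f x\<bar> \<le> (1/2 :: real)}"
    by simp
  then show "{f \<in> borel_measurable (density M (\<lambda>x. ennreal (h x))).
      \<forall>x\<in>space (density M (\<lambda>x. ennreal (h x))). \<bar>f x\<bar> \<le> (1/2 :: real)} \<noteq> {}"
    by blast
  fix g assume "g \<in> {f \<in> borel_measurable (density M (\<lambda>x. ennreal (h x))).
      \<forall>x\<in>space (density M (\<lambda>x. ennreal (h x))). \<bar>f x\<bar> \<le> (1/2 :: real)}"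
  then have [measurable]: "g \<in> borel_measurable M" and g: "\<And>x. x \<in> space M \<Longrightarrow> \<bar>g x\<bar> \<le> 1/2"
    by auto
  have [measurable]: "h \<in> borel_measurable M" "h' \<in> borel_measurable M" using h by auto
  have i: "integrable M (\<lambda>x. u x * g x)" if "integrable M u" for u :: "'a \<Rightarrow> real"
  proof (rule integrable_mult_of_bounded[OF that])
    show "\<bar>g x\<bar> \<le> 1" if "x \<in> space M" for x
      using g[OF that] by simp
  qed measurable
  have "(\<integral>x. g x \<partial>density M (\<lambda>x. ennreal (h x))) - (\<integral>x. g x \<partial>density M (\<lambda>x. ennreal (h' x))) =
      (\<integral>x. (h x - h' x) * g x \<partial>M)"
    using h(3,4) i[OF h(1)] i[OF h(2)] by (simp add: integral_density left_diff_distrib)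
  also have "\<dots> \<le> (\<integral>x. \<bar>h x - h' x\<bar> / 2 \<partial>M)"
  proof (rule integral_mono)
    fix x assume "x \<in> space M"
    then have "\<bar>h x - h' x\<bar> * \<bar>g x\<bar> \<le> \<bar>h x - h' x\<bar> * (1/2)"
      by (intro mult_left_mono g) auto
    then show "(h x - h' x) * g x \<le> \<bar>h x - h' x\<bar> / 2"
      using abs_ge_self[of "(h x - h' x) * g x"] by (simp add: abs_mult)
  qed (use h i in auto)
  finally show "(\<integral>x. g x \<partial>density M (\<lambda>x. ennreal (h x))) - (\<integral>x. g x \<partial>density M (\<lambda>x. ennreal (h' x)))
      \<le> (\<integral>x. \<bar>h x - h' x\<bar> \<partial>M) / 2"
    by simp
qed

section \<open>Dyadic approximation in the cube\<close>

lemma space_cubes: "space (cubes d J) = (\<Pi>\<^sub>E k\<in>J. \<Pi>\<^sub>E j\<in>{..<d k}. {0..1})"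
  by (simp add: cubes_def cube_def space_PiM space_restrict_space)

lemma measurable_cubes_component:
  assumes "k \<in> J" "j < d k"
  shows "(\<lambda>y. y k j) \<in> borel_measurable (cubes d J)"
proof -
  have "(\<lambda>y. y k) \<in> cubes d J \<rightarrow>\<^sub>M cube (d k)"
    unfolding cubes_def using assms by (intro measurable_component_singleton)
  moreover have "(\<lambda>z. z j) \<in> cube (d k) \<rightarrow>\<^sub>M restrict_space borel {0..1}"
    unfolding cube_def using assms by (intro measurable_component_singleton) auto
  then have "(\<lambda>z. z j) \<in> borel_measurable (cube (d k))"
    by (simp add: measurable_restrict_space2_iff)
  ultimately show ?thesis
    by (rule measurable_compose)
qed

text \<open>Rounding down to the grid of mesh \<open>1 / 2^n\<close> keeps coordinates in [0, 1].
  The two restricted abstractions make the result \<open>undefined\<close> outside the index sets,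
  as points of the cube are.\<close>

definition dyadic_floor ::
  "(nat \<Rightarrow> nat) \<Rightarrow> nat set \<Rightarrow> nat \<Rightarrow> (nat \<Rightarrow> nat \<Rightarrow> real) \<Rightarrow> nat \<Rightarrow> nat \<Rightarrow> real" where
  "dyadic_floor d J n y = (\<lambda>k\<in>J. \<lambda>j\<in>{..<d k}. of_int \<lfloor>2^n * y k j\<rfloor> / 2^n)"

text \<open>One countable subset of the cube that contains the dyadic roundings of all
  levels.\<close>

definition rational_points :: "(nat \<Rightarrow> nat) \<Rightarrow> nat set \<Rightarrow> (nat \<Rightarrow> nat \<Rightarrow> real) set" where
  "rational_points d J = (\<Pi>\<^sub>E k\<in>J. \<Pi>\<^sub>E j\<in>{..<d k}. {0..1} \<inter> \<rat>)"

lemma countable_rational_points: "finite J \<Longrightarrow> countable (rational_points d J)"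
  unfolding rational_points_def by (intro countable_PiE countable_Int2 countable_rat) auto

lemma rational_points_subset: "rational_points d J \<subseteq> space (cubes d J)"
  unfolding rational_points_def space_cubes by (intro PiE_mono) auto

lemma floor_dyadic_bounds:
  fixes t :: real
  shows "t - 1 / 2^n \<le> of_int \<lfloor>2^n * t\<rfloor> / 2^n" "of_int \<lfloor>2^n * t\<rfloor> / 2^n \<le> t"
proof -
  have "2^n * t - 1 \<le> of_int \<lfloor>2^n * t\<rfloor>" by linarith
  then have "(2^n * t - 1) / 2^n \<le> of_int \<lfloor>2^n * t\<rfloor> / 2^n" by (intro divide_right_mono) auto
  then show "t - 1 / 2^n \<le> of_int \<lfloor>2^n * t\<rfloor> / 2^n" by (simp add: diff_divide_distrib)
  have "of_int \<lfloor>2^n * t\<rfloor> \<le> 2^n * t" by linarith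
  then show "of_int \<lfloor>2^n * t\<rfloor> / 2^n \<le> t" by (simp add: field_simps)
qed

lemma dyadic_floor_in_rational_points:
  assumes "y \<in> space (cubes d J)"
  shows "dyadic_floor d J n y \<in> rational_points d J"
proof -
  have "(of_int \<lfloor>2^n * y k j\<rfloor> / 2^n :: real) \<in> {0..1} \<inter> \<rat>" if "k \<in> J" "j < d k" for k j
  proof -
    have "y k j \<in> {0..1}"
      using assms that by (auto simp: space_cubes PiE_iff)
    then have "(0 :: real) \<le> of_int \<lfloor>2^n * y k j\<rfloor> / 2^n" "(of_int \<lfloor>2^n * y k j\<rfloor> / 2^n :: real) \<le> 1"
      by (simp, intro order_trans[OF floor_dyadic_bounds(2)]) simp
    moreover have "(of_int \<lfloor>2^n * y k j\<rfloor> / 2^n :: real) \<in> \<rat>"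
      by simp
    ultimately show ?thesis
      by (intro IntI) (simp_all only: atLeastAtMost_iff simp_thms)
  qed
  then show ?thesis by (auto simp: dyadic_floor_def rational_points_def)
qed

text \<open>The target is countable, so preimages of single points suffice, and these are cut out by
  finitely many measurable conditions on coordinates.\<close>

lemma measurable_dyadic_floor:
  assumes "finite J"
  shows "dyadic_floor d J n \<in> cubes d J \<rightarrow>\<^sub>M count_space (rational_points d J)"
  unfolding measurable_count_space_eq_countable[OF countable_rational_points[OF assms]]
proof (intro conjI ballI funcsetI dyadic_floor_in_rational_points)
  fix v assume v: "v \<in> rational_points d J"
  \<comment> \<open>Outside the index sets both functions are \<open>undefined\<close>, so equality
    only has to be tested on the coordinates.\<close>
  have "dyadic_floor d J n y = v \<longleftrightarrow> (\<forall>k\<in>J. \<forall>j\<in>{..<d k}. of_int \<lfloor>2^n * y k j\<rfloor> / 2^n = v k j)"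
    if "y \<in> space (cubes d J)" for y
  proof
    assume *: "\<forall>k\<in>J. \<forall>j\<in>{..<d k}. of_int \<lfloor>2^n * y k j\<rfloor> / 2^n = v k j"
    show "dyadic_floor d J n y = v"
    proof (intro ext)
      fix k j
      show "dyadic_floor d J n y k j = v k j"
        using v * by (cases "k \<in> J"; cases "j < d k")
          (auto simp: dyadic_floor_def rational_points_def PiE_iff extensional_def)
    qed
  qed (auto simp: dyadic_floor_def)
  then have "dyadic_floor d J n -` {v} \<inter> space (cubes d J) =
      {y \<in> space (cubes d J). \<forall>k\<in>J. \<forall>j\<in>{..<d k}. of_int \<lfloor>2^n * y k j\<rfloor> / 2^n = v k j}"
    by auto
  also have "\<dots> \<in> sets (cubes d J)"
  proof (intro sets.sets_Collect_finite_All assms)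
    fix k j assume "k \<in> J" "j \<in> {..<d k}"
    then have [measurable]: "(\<lambda>y. y k j) \<in> borel_measurable (cubes d J)"
      by (intro measurable_cubes_component) auto
    show "{y \<in> space (cubes d J). of_int \<lfloor>2^n * y k j\<rfloor> / 2^n = v k j} \<in> sets (cubes d J)"
      by measurable
  qed auto
  finally show "dyadic_floor d J n -` {v} \<inter> space (cubes d J) \<in> sets (cubes d J)" .
qed

text \<open>The set under \<open>Max\<close> is finite, being the image of a finite index set;
  \<open>0 \<le> c\<close> takes care of the inserted 0.\<close>

lemma sup_norm_le:
  assumes "finite J" "0 \<le> c" "\<And>k j. k \<in> J \<Longrightarrow> j < d k \<Longrightarrow> \<bar>x k j\<bar> \<le> c"
  shows "sup_norm d J x \<le> c"
proof -
  have "{\<bar>x k j\<bar> | k j. k \<in> J \<and> j < d k} = (\<lambda>(k, j). \<bar>x k j\<bar>) ` (SIGMA k:J. {..<d k})"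
    by force
  also have "finite \<dots>" using assms by auto
  finally show ?thesis
    unfolding sup_norm_def using assms by (intro Max.boundedI) auto
qed

text \<open>For a coordinate t, the roundings at levels n and \<open>Suc n\<close> both lie between
  \<open>t - 1 / 2^n\<close> and t. The resulting bound is summable in n, as the construction of the
  density requires.\<close>

lemma sup_norm_dyadic_floor_diff:
  assumes "finite J"
  shows "sup_norm d J (dyadic_floor d J n y - y) \<le> 1 / 2^n"
    "sup_norm d J (dyadic_floor d J (Suc n) y - dyadic_floor d J n y) \<le> 1 / 2^n"
proof -
  show "sup_norm d J (dyadic_floor d J n y - y) \<le> 1 / 2^n"
  proof (rule sup_norm_le[OF assms])
    show "\<bar>(dyadic_floor d J n y - y) k j\<bar> \<le> 1 / 2^n" if "k \<in> J" "j < d k" for k j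
      using that floor_dyadic_bounds[where t="y k j" and n=n] by (simp add: dyadic_floor_def)
  qed simp
  show "sup_norm d J (dyadic_floor d J (Suc n) y - dyadic_floor d J n y) \<le> 1 / 2^n"
  proof (rule sup_norm_le[OF assms])
    have "(1 :: real) / 2 ^ Suc n \<le> 1 / 2 ^ n" by (simp add: field_simps)
    then show "\<bar>(dyadic_floor d J (Suc n) y - dyadic_floor d J n y) k j\<bar> \<le> 1 / 2^n"
      if "k \<in> J" "j < d k" for k j
      using that floor_dyadic_bounds[where t="y k j" and n=n]
        floor_dyadic_bounds[where t="y k j" and n="Suc n"]
      by (simp add: dyadic_floor_def del: power_Suc)
  qed simp
qed

section \<open>Marginals of the given law\<close>

lemma sets_marginal [simp, measurable_cong]: "sets (marginal d \<mu> I) = sets (cubes d I)"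
  by (simp add: marginal_def)

lemma space_marginal [simp]: "space (marginal d \<mu> I) = space (cubes d I)"
  by (simp add: marginal_def)

lemma sets_joint_marginal [simp, measurable_cong]:
  "sets (joint_marginal d \<mu> I J) = sets (cubes d I \<Otimes>\<^sub>M cubes d J)"
  by (simp add: joint_marginal_def)

lemma measurable_restrict_cubes:
  assumes "sets \<mu> = sets (cubes d S)" "I \<subseteq> S"
  shows "(\<lambda>x. restrict x I) \<in> \<mu> \<rightarrow>\<^sub>M cubes d I"
  unfolding measurable_cong_sets[OF assms(1) refl] cubes_def
  using assms(2) by (rule measurable_restrict_subset)

lemma prob_space_marginal:
  assumes "prob_space \<mu>" "sets \<mu> = sets (cubes d S)" "I \<subseteq> S"
  shows "prob_space (marginal d \<mu> I)"
  unfolding marginal_def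
  by (intro prob_space.prob_space_distr assms measurable_restrict_cubes[OF assms(2,3)])

lemma prob_space_joint_marginal:
  assumes "prob_space \<mu>" "sets \<mu> = sets (cubes d S)" "I \<subseteq> S" "J \<subseteq> S"
  shows "prob_space (joint_marginal d \<mu> I J)"
  unfolding joint_marginal_def
  using measurable_restrict_cubes[OF assms(2,3)] measurable_restrict_cubes[OF assms(2,4)]
  by (intro prob_space.prob_space_distr assms measurable_Pair)

text \<open>Restriction to J always lands in the cube, so both sides measure the same preimage. This
  identifies the law of the I-block as the first marginal of the joint law.\<close>

lemma emeasure_joint_marginal_Times_space:
  assumes \<mu>: "sets \<mu> = sets (cubes d S)" "I \<subseteq> S" "J \<subseteq> S" and A: "A \<in> sets (cubes d I)"
  shows "emeasure (joint_marginal d \<mu> I J) (A \<times> space (cubes d J)) = emeasure (marginal d \<mu> I) A"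
proof -
  note [measurable] = measurable_restrict_cubes[OF \<mu>(1,2)] measurable_restrict_cubes[OF \<mu>(1,3)] A
  show ?thesis
    unfolding joint_marginal_def marginal_def
    using measurable_space[OF measurable_restrict_cubes[OF \<mu>(1,3)]]
    by (subst (1 2) emeasure_distr) (auto intro!: arg_cong[where f="emeasure \<mu>"])
qed

section \<open>Equivalence of the two Lipschitz conditions\<close>

theorem lemma3p5:
  fixes K :: nat and d :: "nat \<Rightarrow> nat" and \<mu> :: "(nat \<Rightarrow> nat \<Rightarrow> real) measure"
    and I J :: "nat set" and L :: real
  assumes "prob_space \<mu>" and "sets \<mu> = sets (cubes d {1..K})"
    and "I \<subseteq> {1..K}" and "J \<subseteq> {1..K}" and "I \<inter> J = {}" and "I \<noteq> {}" and "J \<noteq> {}"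
    and "L > 0"
  shows "(\<exists>\<kappa>. is_cond_kernel d \<mu> I J \<kappa> \<and>
            (\<forall>y\<in>space (cubes d J). \<forall>y'\<in>space (cubes d J).
               tv (\<kappa> y) (\<kappa> y') \<le> L * sup_norm d J (y - y')))
     \<longleftrightarrow>
         (absolutely_continuous (marginal d \<mu> I \<Otimes>\<^sub>M marginal d \<mu> J) (joint_marginal d \<mu> I J) \<and>
          (\<exists>f. is_RN_version d \<mu> I J f \<and>
            (\<forall>y\<in>space (cubes d J). \<forall>y'\<in>space (cubes d J).
               (\<integral>x. \<bar>f (x, y) - f (x, y')\<bar> \<partial>marginal d \<mu> I) \<le> 2 * L * sup_norm d J (y - y'))))"
    (is "?kernel \<longleftrightarrow> ?density")
proof -
  let ?M = "marginal d \<mu> I" and ?N = "marginal d \<mu> J" and ?P = "joint_marginal d \<mu> I J"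
  interpret M: prob_space ?M by (rule prob_space_marginal) fact+
  interpret N: prob_space ?N by (rule prob_space_marginal) fact+
  interpret P: prob_space ?P by (rule prob_space_joint_marginal) fact+
  interpret MN: pair_sigma_finite ?M ?N ..
  have finJ: "finite J" using assms(4) finite_subset by blast
  have sets_MN: "sets (?M \<Otimes>\<^sub>M ?N) = sets (cubes d I \<Otimes>\<^sub>M cubes d J)"
    by (intro sets_pair_measure_cong) auto
  show ?thesis
  proof
    assume ?kernel
    then obtain \<kappa> where \<kappa>_meas: "\<kappa> \<in> cubes d J \<rightarrow>\<^sub>M prob_algebra (cubes d I)"
      and \<kappa>_joint: "\<And>A B. A \<in> sets (cubes d I) \<Longrightarrow> B \<in> sets (cubes d J) \<Longrightarrow>
        emeasure ?P (A \<times> B) = (\<integral>\<^sup>+y\<in>B. emeasure (\<kappa> y) A \<partial>?N)"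
      and Lip: "\<And>y y'. y \<in> space (cubes d J) \<Longrightarrow> y' \<in> space (cubes d J) \<Longrightarrow>
        tv (\<kappa> y) (\<kappa> y') \<le> L * sup_norm d J (y - y')"
      unfolding is_cond_kernel_def by blast
    have \<kappa>: "prob_space (\<kappa> y)" "sets (\<kappa> y) = sets ?M" if "y \<in> space (cubes d J)" for y
      using measurable_space[OF \<kappa>_meas that] by (auto simp: space_prob_algebra)
    let ?r = "dyadic_floor d J"
    have r: "?r n y \<in> space (cubes d J)" if "y \<in> space (cubes d J)" for n y
      using dyadic_floor_in_rational_points[OF that] rational_points_subset by blast
    have "\<exists>Z\<in>null_sets ?M. \<exists>f\<in>borel_measurable (?M \<Otimes>\<^sub>M cubes d J). (\<forall>z. 0 \<le> f z) \<and>
      (\<forall>y\<in>space (cubes d J). integrable ?M (\<lambda>x. f (x, y)) \<and>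
        (\<forall>g\<in>borel_measurable ?M. (\<forall>x\<in>space ?M. \<bar>g x\<bar> \<le> 1) \<longrightarrow>
          (\<integral>x. f (x, y) * g x \<partial>?M) = (\<integral>x. average_on ?M Z g x \<partial>\<kappa> y)))"
    \<comment> \<open>Consecutive dyadic roundings of y are at distance at most
      \<open>1 / 2^n\<close>, so the Lipschitz condition bounds the distances of their kernels by
      the terms of a geometric series.\<close>
    proof (rule ex_jointly_measurable_density[where r="?r" and D="rational_points d J" and e="\<lambda>n. L * (1/2)^n"])
      show "tv (\<kappa> (?r (Suc n) y)) (\<kappa> (?r n y)) \<le> L * (1/2)^n" if "y \<in> space (cubes d J)" for n y
      proof -
        have "L * sup_norm d J (?r (Suc n) y - ?r n y) \<le> L * (1 / 2^n)"
          using \<open>L > 0\<close> sup_norm_dyadic_floor_diff(2)[OF finJ] by (intro mult_left_mono) auto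
        then show ?thesis
          using Lip[OF r[OF that] r[OF that], of "Suc n" n] by (simp add: power_one_over)
      qed
      show "(\<lambda>n. tv (\<kappa> (?r n y)) (\<kappa> y)) \<longlonglongrightarrow> 0" if y: "y \<in> space (cubes d J)" for y
      proof (rule tendsto_sandwich[OF _ _ tendsto_const])
        have "tv (\<kappa> (?r n y)) (\<kappa> y) \<ge> 0" for n
          using tv_upper[of "\<kappa> (?r n y)" "\<kappa> y" "\<lambda>_. 0"] \<kappa>[OF y] \<kappa>[OF r[OF y]] by simp
        then show "\<forall>\<^sub>F n in sequentially. 0 \<le> tv (\<kappa> (?r n y)) (\<kappa> y)" by simp
        have "tv (\<kappa> (?r n y)) (\<kappa> y) \<le> L * (1/2)^n" for n
        proof -
          have "L * sup_norm d J (?r n y - y) \<le> L * (1 / 2^n)"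
            using \<open>L > 0\<close> sup_norm_dyadic_floor_diff(1)[OF finJ] by (intro mult_left_mono) auto
          then show ?thesis
            using Lip[OF r[OF y] y, of n] by (simp add: power_one_over)
        qed
        then show "\<forall>\<^sub>F n in sequentially. tv (\<kappa> (?r n y)) (\<kappa> y) \<le> L * (1/2)^n" by simp
        show "(\<lambda>n. L * (1/2)^n) \<longlonglongrightarrow> 0"
          by (intro tendsto_mult_right_zero LIMSEQ_power_zero) simp
      qed
      show "summable (\<lambda>n. L * (1/2)^n)"
        by (intro summable_mult summable_geometric) simp
    qed (fact M.prob_space_axioms | erule \<kappa> | rule countable_rational_points[OF finJ]
        rational_points_subset measurable_dyadic_floor[OF finJ])+
    then obtain Z f where Z: "Z \<in> null_sets ?M"
      and f_meas: "f \<in> borel_measurable (?M \<Otimes>\<^sub>M cubes d J)" and f0: "\<And>z. 0 \<le> f z"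
      and f_slice: "\<forall>y\<in>space (cubes d J). integrable ?M (\<lambda>x. f (x, y)) \<and>
        (\<forall>g\<in>borel_measurable ?M. (\<forall>x\<in>space ?M. \<bar>g x\<bar> \<le> 1) \<longrightarrow>
          (\<integral>x. f (x, y) * g x \<partial>?M) = (\<integral>x. average_on ?M Z g x \<partial>\<kappa> y))"
      by (elim bexE conjE) (rule that; simp only:)
    have f_int: "integrable ?M (\<lambda>x. f (x, y))" if "y \<in> space (cubes d J)" for y
      using f_slice that by blast
    have f_eq: "(\<integral>x. f (x, y) * g x \<partial>?M) = (\<integral>x. average_on ?M Z g x \<partial>\<kappa> y)"
      if "y \<in> space (cubes d J)" "g \<in> borel_measurable ?M" "\<And>x. x \<in> space ?M \<Longrightarrow> \<bar>g x\<bar> \<le> 1" for y g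
      using bspec[OF f_slice that(1)] that(2,3) by blast
    have f_cubes: "f \<in> borel_measurable (cubes d I \<Otimes>\<^sub>M cubes d J)"
      using f_meas by (simp cong: measurable_cong_sets sets_pair_measure_cong)
    have f_MN: "f \<in> borel_measurable (?M \<Otimes>\<^sub>M ?N)"
      using f_cubes unfolding measurable_cong_sets[OF sets_MN refl] .
    have P: "?P = density (?M \<Otimes>\<^sub>M ?N) (\<lambda>z. ennreal (f z))"
    proof (rule density_eq_of_kernel[where \<kappa>=\<kappa> and Z=Z])
      show "(\<lambda>y. emeasure (\<kappa> y) A) \<in> borel_measurable ?N" if "A \<in> sets ?M" for A
        using measurable_emeasure_kernel[OF measurable_prob_algebraD[OF \<kappa>_meas], of A] that
        by simp
      show "emeasure ?M A = emeasure ?P (A \<times> space ?N)" if "A \<in> sets ?M" for A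
        using emeasure_joint_marginal_Times_space[OF assms(2-4)] that by simp
    qed (use \<kappa> \<kappa>_joint Z f_MN f0 f_int f_eq sets_MN M.prob_space_axioms N.prob_space_axioms
        P.finite_measure_axioms in auto)
    have "absolutely_continuous (?M \<Otimes>\<^sub>M ?N) ?P"
      unfolding P using f_MN by (intro absolutely_continuousI_density) auto
    moreover have "is_RN_version d \<mu> I J f"
      unfolding is_RN_version_def
    proof (intro conjI ballI)
      show "AE z in ?M \<Otimes>\<^sub>M ?N. ennreal (f z) = RN_deriv (?M \<Otimes>\<^sub>M ?N) ?P z"
        using f_MN P by (intro MN.RN_deriv_unique) auto
      fix y assume y: "y \<in> space (cubes d J)"
      interpret k: prob_space "\<kappa> y" using \<kappa>[OF y] by simp
      \<comment> \<open>The constant 1 is unchanged by averaging. Testing with it yields total mass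
        1 at every y, including those off the support of the law of the J-block.\<close>
      have "(\<integral>x. f (x, y) \<partial>?M) = (\<integral>x. average_on ?M Z (\<lambda>_. 1) x \<partial>\<kappa> y)"
        using f_eq[OF y, of "\<lambda>_. 1"] by simp
      also have "\<dots> = 1"
        using M.prob_space k.prob_space by (simp add: average_on_def cong: if_cong)
      finally show "(\<integral>x. f (x, y) \<partial>?M) = 1" .
    qed (use f_cubes f0 f_int in auto)
    moreover have "(\<integral>x. \<bar>f (x, y) - f (x, y')\<bar> \<partial>?M) \<le> 2 * L * sup_norm d J (y - y')"
      if y: "y \<in> space (cubes d J)" "y' \<in> space (cubes d J)" for y y'
    proof -
      \<comment> \<open>Both slices belong to the same Z, so they can be compared at arbitrary y and
        y', with no further passage through dyadic points.\<close>
      have "(\<integral>x. \<bar>f (x, y) - f (x, y')\<bar> \<partial>?M) \<le> 2 * tv (\<kappa> y) (\<kappa> y')"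
        by (rule L1_dist_le_tv[OF M.prob_space_axioms \<kappa>(1)[OF y(1)] \<kappa>(1)[OF y(2)] \<kappa>(2)[OF y(1)]
              \<kappa>(2)[OF y(2)] null_setsD2[OF Z] f_int[OF y(1)] f_int[OF y(2)] f_eq[OF y(1)] f_eq[OF y(2)]])
      also have "\<dots> \<le> 2 * (L * sup_norm d J (y - y'))"
        using Lip[OF y] by simp
      finally show ?thesis by simp
    qed
    ultimately show ?density by blast
  next
    assume ?density
    then obtain f where ac: "absolutely_continuous (?M \<Otimes>\<^sub>M ?N) ?P"
      and f_cubes [measurable]: "f \<in> borel_measurable (cubes d I \<Otimes>\<^sub>M cubes d J)"
      and f0: "\<And>x y. x \<in> space (cubes d I) \<Longrightarrow> y \<in> space (cubes d J) \<Longrightarrow> 0 \<le> f (x, y)"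
      and RN: "AE z in ?M \<Otimes>\<^sub>M ?N. ennreal (f z) = RN_deriv (?M \<Otimes>\<^sub>M ?N) ?P z"
      and f_int: "\<And>y. y \<in> space (cubes d J) \<Longrightarrow> integrable ?M (\<lambda>x. f (x, y))"
      and f_1: "\<And>y. y \<in> space (cubes d J) \<Longrightarrow> (\<integral>x. f (x, y) \<partial>?M) = 1"
      and Lip: "\<And>y y'. y \<in> space (cubes d J) \<Longrightarrow> y' \<in> space (cubes d J) \<Longrightarrow>
        (\<integral>x. \<bar>f (x, y) - f (x, y')\<bar> \<partial>?M) \<le> 2 * L * sup_norm d J (y - y')"
      unfolding is_RN_version_def by (auto simp: space_pair_measure)
    have f_MN [measurable]: "f \<in> borel_measurable (?M \<Otimes>\<^sub>M ?N)"
      using f_cubes unfolding measurable_cong_sets[OF sets_MN refl] .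
    have "density (?M \<Otimes>\<^sub>M ?N) (\<lambda>z. ennreal (f z)) = density (?M \<Otimes>\<^sub>M ?N) (RN_deriv (?M \<Otimes>\<^sub>M ?N) ?P)"
      by (rule density_cong) (use RN in auto)
    also have "\<dots> = ?P"
      using ac sets_MN by (intro MN.density_RN_deriv) auto
    finally have P: "?P = density (?M \<Otimes>\<^sub>M ?N) (\<lambda>z. ennreal (f z))" by simp
    \<comment> \<open>Since every slice of f is nonnegative with integral 1, this is a probability
      measure at every point of the cube and not just almost everywhere.\<close>
    define \<kappa> where "\<kappa> y = density ?M (\<lambda>x. ennreal (f (x, y)))" for y
    have emeasure_\<kappa>: "emeasure (\<kappa> y) A = (\<integral>\<^sup>+x\<in>A. ennreal (f (x, y)) \<partial>?M)"
      if "y \<in> space (cubes d J)" "A \<in> sets (cubes d I)" for y A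
      unfolding \<kappa>_def using that borel_measurable_integrable[OF f_int[OF that(1)]]
      by (intro emeasure_density) auto
    have prob_\<kappa>: "prob_space (\<kappa> y)" if y: "y \<in> space (cubes d J)" for y
    proof (rule prob_spaceI)
      have "emeasure (\<kappa> y) (space (\<kappa> y)) = (\<integral>\<^sup>+x. ennreal (f (x, y)) \<partial>?M)"
        using emeasure_\<kappa>[OF y sets.top] by (auto simp: \<kappa>_def intro!: nn_integral_cong)
      also have "\<dots> = ennreal (\<integral>x. f (x, y) \<partial>?M)"
        using f_int[OF y] f0 y by (intro nn_integral_eq_integral) auto
      finally show "emeasure (\<kappa> y) (space (\<kappa> y)) = 1"
        using f_1[OF y] by simp
    qed
    have "\<kappa> \<in> cubes d J \<rightarrow>\<^sub>M prob_algebra (cubes d I)"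
    proof (intro measurable_prob_algebraI measurable_subprob_algebra)
      fix A assume A [measurable]: "A \<in> sets (cubes d I)"
      have "(\<lambda>y. \<integral>\<^sup>+x. ennreal (f (x, y)) * indicator A x \<partial>?M) \<in> borel_measurable (cubes d J)"
        by measurable
      then show "(\<lambda>y. emeasure (\<kappa> y) A) \<in> borel_measurable (cubes d J)"
        by (subst measurable_cong[OF emeasure_\<kappa>]) (use A in auto)
    qed (auto intro!: prob_\<kappa> prob_space_imp_subprob_space simp: \<kappa>_def[THEN arg_cong[where f=sets]])
    moreover have "emeasure ?P (A \<times> B) = (\<integral>\<^sup>+y\<in>B. emeasure (\<kappa> y) A \<partial>?N)"
      if "A \<in> sets (cubes d I)" "B \<in> sets (cubes d J)" for A B
    proof -
      have "emeasure ?P (A \<times> B) = (\<integral>\<^sup>+y\<in>B. (\<integral>\<^sup>+x\<in>A. ennreal (f (x, y)) \<partial>?M) \<partial>?N)"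
        unfolding P using that
        by (intro emeasure_density_Times M.sigma_finite_measure_axioms N.sigma_finite_measure_axioms) auto
      also have "\<dots> = (\<integral>\<^sup>+y\<in>B. emeasure (\<kappa> y) A \<partial>?N)"
        using that by (intro nn_integral_cong) (simp add: emeasure_\<kappa>)
      finally show ?thesis .
    qed
    moreover have "tv (\<kappa> y) (\<kappa> y') \<le> L * sup_norm d J (y - y')"
      if y: "y \<in> space (cubes d J)" "y' \<in> space (cubes d J)" for y y'
    proof -
      \<comment> \<open>The factor 1/2 turns the constant 2L of the densities into L.\<close>
      have "tv (\<kappa> y) (\<kappa> y') \<le> (\<integral>x. \<bar>f (x, y) - f (x, y')\<bar> \<partial>?M) / 2"
        unfolding \<kappa>_def using f_int f0 y by (intro tv_density_le) auto
      with Lip[OF y] show ?thesis by simp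
    qed
    ultimately show ?kernel
      unfolding is_cond_kernel_def by (intro exI[of _ \<kappa>]) auto
  qed
qed

end
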